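(* For every $n,m\ge 1$, the uncovering-resilience of a synchronized communication system (SCS) whose communication graph is the $n\times m$ grid communication graph equals $$\frac{n\cdot m}{\gcd(n,m)}-1.$$
   Context: Model. A system consists of pairwise disjoint unit circles $C_1,\dots,C_N$ in the plane (trajectories) and a communication range $r>0$. Its communication graph $G$ has vertex set $\{C_1,\dots,C_N\}$, with $C_i,C_j$ adjacent iff the distance between their centres is at most $2+r$; $G$ is assumed connected. Positions on a circle are angles measured from the positive horizontal axis, taken modulo $2\pi$. For an edge $(i,j)$, the link position $\phi_{ij}$ is the angle of the point of $C_i$ closest to $C_j$. A schedule is a pair $F=(f,g)$ with $f(C_i)\in[0,2\pi)$ and $g(C_i)\in\{1,-1\}$ ($1$ = counterclockwise, $-1$ = clockwise); a robot following the schedule on $C_i$ is at angle $f(C_i)+g(C_i)\cdot 2\pi t$ at time $t$ (one time unit = one tour). $F$ is a synchronization schedule if $g(C_i)=-g(C_j)$ for every edge $(i,j)$ and, for every edge $(i,j)$, robots following $F$ on $C_i$ and $C_j$ are at $\phi_{ij}$ and $\phi_{ji}$ respectively at exactly the same times. A synchronized communication system (SCS) consists of $N$ identical robots, initially one on each circle, following a synchronization schedule $F$, with the switching rule: whenever a robot on $C_i$ reaches $\phi_{ij}$ at time $t$ and $C_j$ contains no robot, it instantly passes to $C_j$ and from then on follows the schedule of $C_j$ (at time $t+\varepsilon$ it is at $f(C_j)+g(C_j)2\pi(t+\varepsilon)$); if $C_j$ contains a robot (which is then at $\phi_{ji}$), the two meet and each stays on its own circle. A partial SCS is obtained from an SCS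 by letting some robots leave (possibly at different times); the remaining robots never leave. A circle is covered if every point of it is visited periodically by the surviving robots. The uncovering-resilience of an SCS is the largest number $k$ such that, whichever $k$ robots leave (at whatever times), all circles remain covered by the surviving robots. Grid. The $n\times m$ grid communication graph consists of $nm$ unit circles, circle $(i,j)$ lying in row $i\in\{1,\dots,n\}$ (rows horizontal, row 1 on top) and column $j\in\{1,\dots,m\}$ (columns vertical, column 1 on the left), with centres on a square lattice such that circle $(i,j)$ is adjacent in $G$ exactly to the circles $(i\pm1,j)$ and $(i,j\pm1)$ that exist. *)

theory Defs
  imports "HOL-Analysis.Analysis"
begin

text \<open>Circles are indexed by vertices of type 'v in a finite set V; circle i is the unit
circle with centre c i (a complex number).  Angles are compared modulo 2 pi via cis.\<close>

definition comm_adj :: "'v set \<Rightarrow> ('v \<Rightarrow> complex) \<Rightarrow> real \<Rightarrow> 'v \<Rightarrow> 'v \<Rightarrow> bool" where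
  "comm_adj V c r i j \<longleftrightarrow> i \<in> V \<and> j \<in> V \<and> i \<noteq> j \<and> cmod (c i - c j) \<le> 2 + r"

definition pos :: "('v \<Rightarrow> real) \<Rightarrow> ('v \<Rightarrow> real) \<Rightarrow> 'v \<Rightarrow> real \<Rightarrow> real" where
  "pos f g i t = f i + g i * 2 * pi * t"

text \<open>A robot following the schedule on circle i is at the link position phi_ij at time t,
 i.e. at the point of circle i closest to circle j (direction sgn (c j - c i)).\<close>
definition at_link :: "('v \<Rightarrow> complex) \<Rightarrow> ('v \<Rightarrow> real) \<Rightarrow> ('v \<Rightarrow> real) \<Rightarrow> 'v \<Rightarrow> 'v \<Rightarrow> real \<Rightarrow> bool" where
  "at_link c f g i j t \<longleftrightarrow> cis (pos f g i t) = sgn (c j - c i)"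

definition sync_schedule :: "'v set \<Rightarrow> ('v \<Rightarrow> complex) \<Rightarrow> real \<Rightarrow> ('v \<Rightarrow> real) \<Rightarrow> ('v \<Rightarrow> real) \<Rightarrow> bool" where
  "sync_schedule V c r f g \<longleftrightarrow>
     (\<forall>i\<in>V. 0 \<le> f i \<and> f i < 2 * pi \<and> (g i = 1 \<or> g i = -1)) \<and>
     (\<forall>i j. comm_adj V c r i j \<longrightarrow> g i = - g j \<and> (\<forall>t. at_link c f g i j t \<longleftrightarrow> at_link c f g j i t))"

definition link_event :: "'v set \<Rightarrow> ('v \<Rightarrow> complex) \<Rightarrow> real \<Rightarrow> ('v \<Rightarrow> real) \<Rightarrow> ('v \<Rightarrow> real) \<Rightarrow> real \<Rightarrow> bool" where
  "link_event V c r f g u \<longleftrightarrow> (\<exists>i j. comm_adj V c r i j \<and> at_link c f g i j u)"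

text \<open>Robots are indexed by their initial circle.  The robots in S leave, robot q at time tau q
 (it is absent from time tau q on); the robots outside S never leave.\<close>
definition present :: "'v set \<Rightarrow> ('v \<Rightarrow> real) \<Rightarrow> 'v \<Rightarrow> real \<Rightarrow> bool" where
  "present S tau q t \<longleftrightarrow> q \<notin> S \<or> t < tau q"

definition occupied :: "'v set \<Rightarrow> 'v set \<Rightarrow> ('v \<Rightarrow> real) \<Rightarrow> ('v \<Rightarrow> real \<Rightarrow> 'v) \<Rightarrow> 'v \<Rightarrow> real \<Rightarrow> bool" where
  "occupied V S tau L p t \<longleftrightarrow> (\<exists>q\<in>V. present S tau q t \<and> L q t = p)"

text \<open>L q t is the circle on which robot q is at time t (meaningful while q is present); a robot
 on circle p at time t is at angle pos f g p t.  At a switching instant u the robot is still on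
 its old circle and is on the new circle right after u.\<close>
definition is_run :: "'v set \<Rightarrow> ('v \<Rightarrow> complex) \<Rightarrow> real \<Rightarrow> ('v \<Rightarrow> real) \<Rightarrow> ('v \<Rightarrow> real) \<Rightarrow>
    'v set \<Rightarrow> ('v \<Rightarrow> real) \<Rightarrow> ('v \<Rightarrow> real \<Rightarrow> 'v) \<Rightarrow> bool" where
  "is_run V c r f g S tau L \<longleftrightarrow>
     (\<forall>q\<in>V. L q 0 = q) \<and>
     (\<forall>q\<in>V. \<forall>s t. 0 \<le> s \<and> s < t \<and> (\<forall>u. s \<le> u \<and> u < t \<longrightarrow> \<not> link_event V c r f g u)
          \<longrightarrow> L q t = L q s) \<and>
     (\<forall>q\<in>V. \<forall>u. 0 \<le> u \<and> link_event V c r f g u \<and> present S tau q u \<longrightarrow>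
        (\<exists>\<delta>>0. \<forall>t. u < t \<and> t < u + \<delta> \<longrightarrow>
          (if (\<exists>j. comm_adj V c r (L q u) j \<and> at_link c f g (L q u) j u \<and> \<not> occupied V S tau L j u)
           then comm_adj V c r (L q u) (L q t) \<and> at_link c f g (L q u) (L q t) u
                \<and> \<not> occupied V S tau L (L q t) u
           else L q t = L q u)))"

definition covered :: "'v set \<Rightarrow> ('v \<Rightarrow> real) \<Rightarrow> ('v \<Rightarrow> real) \<Rightarrow> 'v set \<Rightarrow> ('v \<Rightarrow> real \<Rightarrow> 'v) \<Rightarrow> 'v \<Rightarrow> bool" where
  "covered V f g S L p \<longleftrightarrow>
     (\<exists>P>0. \<forall>\<theta>. \<forall>T\<ge>0. \<exists>t. T \<le> t \<and> t \<le> T + P \<and>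
        (\<exists>q\<in>V - S. L q t = p \<and> cis (pos f g p t) = cis \<theta>))"

definition resilient_for :: "'v set \<Rightarrow> ('v \<Rightarrow> complex) \<Rightarrow> real \<Rightarrow> ('v \<Rightarrow> real) \<Rightarrow> ('v \<Rightarrow> real) \<Rightarrow> nat \<Rightarrow> bool" where
  "resilient_for V c r f g k \<longleftrightarrow>
     (\<forall>S tau L. S \<subseteq> V \<and> card S = k \<and> (\<forall>q\<in>S. 0 \<le> tau q) \<and> is_run V c r f g S tau L
        \<longrightarrow> (\<forall>p\<in>V. covered V f g S L p))"

definition uncovering_resilience :: "'v set \<Rightarrow> ('v \<Rightarrow> complex) \<Rightarrow> real \<Rightarrow> ('v \<Rightarrow> real) \<Rightarrow> ('v \<Rightarrow> real) \<Rightarrow> nat" where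
  "uncovering_resilience V c r f g = (GREATEST k. k \<le> card V \<and> resilient_for V c r f g k)"

definition grid_V :: "nat \<Rightarrow> nat \<Rightarrow> (nat \<times> nat) set" where
  "grid_V n m = {1..n} \<times> {1..m}"

text \<open>Circle (i,j) (row i from the top, column j from the left) has centre (d j, - d i).\<close>
definition grid_centre :: "real \<Rightarrow> nat \<times> nat \<Rightarrow> complex" where
  "grid_centre d p = Complex (d * real (snd p)) (- (d * real (fst p)))"

definition grid_adj :: "nat \<times> nat \<Rightarrow> nat \<times> nat \<Rightarrow> bool" where
  "grid_adj p q \<longleftrightarrow>
     (fst p = fst q \<and> (snd q = snd p + 1 \<or> snd p = snd q + 1)) \<or>
     (snd p = snd q \<and> (fst q = fst p + 1 \<or> fst p = fst q + 1))"

end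

(* Reflecting along each edge, synchronization makes every link be reached at one of four phases per
   time unit, at which disjoint pairs of neighbouring columns (two phases) or rows (two phases) are
   linked.  As far as occupied circles are concerned, two meeting robots may be thought to exchange
   circles, so without departures the occupied set moves by a fixed permutation of the circles per
   time unit.  It acts on columns as an m-cycle and on rows as an n-cycle, hence all its orbits have
   lcm n m elements.  Fewer departures leave an occupied circle in every orbit; removing all robots
   of one orbit at time 0 leaves its circles unvisited forever at integer times. *)

theory Submission
  imports Defs "HOL-Number_Theory.Cong"
begin

section \<open>Alternating adjacent swaps on a path\<close>

definition path_swap :: "bool \<Rightarrow> nat \<Rightarrow> nat \<Rightarrow> nat" where
  "path_swap e m b =
     (if odd b = e then (if b < m then b + 1 else b) else (if 1 < b then b - 1 else b))"

text \<open>The path unfolded to a cycle of length \<open>2 * m\<close>: the positions that \<open>path_swap e m\<close> moves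
  right on one side, those that it moves left on the other.  Every swap then advances by 1.\<close>
definition unfolded :: "bool \<Rightarrow> nat \<Rightarrow> int" where
  "unfolded e b = (if odd b = e then int b - 1 else - int b)"

lemma path_swap_in: "b \<in> {1..m} \<Longrightarrow> path_swap e m b \<in> {1..m}"
  by (auto simp: path_swap_def)

lemma path_swap_invol: "b \<in> {1..m} \<Longrightarrow> path_swap e m (path_swap e m b) = b"
  by (auto simp: path_swap_def)

text \<open>Moving by one changes the parity, so a moved position keeps its direction under the
  opposite swap; an unpaired end stays but reverses direction, which is the turn of the unfolded
  cycle. Only the right end wraps around, from \<open>m - 1\<close> to \<open>- m\<close>.\<close>

lemma unfolded_path_swap:
  assumes "b \<in> {1..m}"
  shows "[unfolded (\<not> e) (path_swap e m b) = unfolded e b + 1] (mod (2 * int m))"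
proof (cases "odd b = e \<and> b = m")
  case True
  then have "unfolded (\<not> e) (path_swap e m b) = - int m" "unfolded e b = int m - 1"
    by (auto simp: path_swap_def unfolded_def)
  then show ?thesis by (simp add: cong_iff_dvd_diff)
next
  case False
  then have "unfolded (\<not> e) (path_swap e m b) = unfolded e b + 1"
    using assms by (auto simp: path_swap_def unfolded_def)
  then show ?thesis by simp
qed

text \<open>All values lie between \<open>- m\<close> and \<open>m - 1\<close>, a full residue
  system modulo \<open>2 * m\<close>, and their sign tells the two sides apart.\<close>

lemma unfolded_inj:
  assumes b: "b \<in> {1..m}" and b': "b' \<in> {1..m}"
    and eq: "[unfolded e b = unfolded e b'] (mod (2 * int m))"
  shows "b = b'"
proof -
  have *: "x = 0" if "2 * int m dvd x" "\<bar>x\<bar> < 2 * int m" for x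
    using that zdvd_not_zless[of "\<bar>x\<bar>" "2 * int m"] by (cases "x = 0") auto
  have d: "2 * int m dvd unfolded e b - unfolded e b'"
    using eq by (simp add: cong_iff_dvd_diff)
  have "\<bar>unfolded e b - unfolded e b'\<bar> < 2 * int m"
  proof (cases "odd b = odd b'")
    case True
    then show ?thesis using b b' by (auto simp: unfolded_def)
  next
    case False
    then have "b \<noteq> b'" by auto
    then show ?thesis using b b' by (auto simp: unfolded_def)
  qed
  from *[OF d this] have z: "unfolded e b = unfolded e b'" by simp
  show ?thesis
  proof (cases "odd b = odd b'")
    case True
    then show ?thesis using z by (auto simp: unfolded_def split: if_splits)
  next
    case False
    then show ?thesis using z b b' by (auto simp: unfolded_def split: if_splits)
  qed
qed

definition double_swap :: "bool \<Rightarrow> nat \<Rightarrow> nat \<Rightarrow> nat" where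
  "double_swap e m b = path_swap (\<not> e) m (path_swap e m b)"

lemma double_swap_in: "b \<in> {1..m} \<Longrightarrow> double_swap e m b \<in> {1..m}"
  unfolding double_swap_def by (intro path_swap_in)

lemma unfolded_double_swap:
  assumes "b \<in> {1..m}"
  shows "[unfolded e (double_swap e m b) = unfolded e b + 2] (mod (2 * int m))"
proof -
  have "[unfolded (\<not> e) (path_swap e m b) + 1 = (unfolded e b + 1) + 1] (mod (2 * int m))"
    by (intro cong_add unfolded_path_swap assms cong_refl)
  then have "[unfolded (\<not> e) (path_swap e m b) + 1 = unfolded e b + 2] (mod (2 * int m))"
    by (simp add: algebra_simps)
  moreover have "[unfolded e (double_swap e m b)
      = unfolded (\<not> e) (path_swap e m b) + 1] (mod (2 * int m))"
    using unfolded_path_swap[OF path_swap_in[OF assms], of "\<not> e" e] by (simp add: double_swap_def)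
  ultimately show ?thesis by (blast intro: cong_trans)
qed

lemma double_swap_pow_in: "b \<in> {1..m} \<Longrightarrow> (double_swap e m ^^ i) b \<in> {1..m}"
proof (induction i)
  case (Suc i)
  then show ?case using double_swap_in[of "(double_swap e m ^^ i) b" m e] by simp
qed simp

lemma unfolded_double_swap_pow:
  assumes "b \<in> {1..m}"
  shows "[unfolded e ((double_swap e m ^^ i) b) = unfolded e b + 2 * int i] (mod (2 * int m))"
proof (induction i)
  case (Suc i)
  have "[unfolded e (double_swap e m ((double_swap e m ^^ i) b))
      = unfolded e ((double_swap e m ^^ i) b) + 2] (mod (2 * int m))"
    by (intro unfolded_double_swap double_swap_pow_in assms)
  also have "[unfolded e ((double_swap e m ^^ i) b) + 2
      = (unfolded e b + 2 * int i) + 2] (mod (2 * int m))"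
    by (intro cong_add Suc cong_refl)
  finally show ?case by (simp add: algebra_simps)
qed simp

text \<open>For fixed \<open>e\<close> all unfolded positions have the same parity, and a double
  swap advances them by 2 on a cycle of length \<open>2 * m\<close>: it is a single
  \<open>m\<close>-cycle.\<close>

lemma double_swap_pow_eq_iff:
  assumes b: "b \<in> {1..m}"
  shows "(double_swap e m ^^ i) b = (double_swap e m ^^ j) b \<longleftrightarrow> [i = j] (mod m)"
proof -
  let ?x = "\<lambda>i. unfolded e ((double_swap e m ^^ i) b)"
  have "(double_swap e m ^^ i) b = (double_swap e m ^^ j) b \<longleftrightarrow> [?x i = ?x j] (mod (2 * int m))"
    using unfolded_inj[OF double_swap_pow_in[OF b] double_swap_pow_in[OF b]] by auto
  also have "\<dots> \<longleftrightarrow> [unfolded e b + 2 * int i = unfolded e b + 2 * int j] (mod (2 * int m))"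
    using unfolded_double_swap_pow[OF b, of e] by (meson cong_sym cong_trans)
  also have "\<dots> \<longleftrightarrow> [2 * int i = 2 * int j] (mod (2 * int m))"
    by (rule cong_add_lcancel)
  also have "\<dots> \<longleftrightarrow> [int i = int j] (mod int m)"
    by (metis cong_iff_dvd_diff dvd_mult_cancel_left right_diff_distrib zero_neq_numeral)
  finally show ?thesis by (simp add: cong_int_iff)
qed

section \<open>Quarter turns on the grid\<close>

text \<open>The exchange that takes place when the robot on circle \<open>(1, 1)\<close> is at angle \<open>j * pi / 2\<close>.\<close>
definition quarter_step :: "nat \<Rightarrow> nat \<Rightarrow> int \<Rightarrow> nat \<times> nat \<Rightarrow> nat \<times> nat" where
  "quarter_step n m j p =
     (if even j then (fst p, path_swap (j mod 4 = 0) m (snd p))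
      else (path_swap (j mod 4 = 3) n (fst p), snd p))"

lemma quarter_step_in: "p \<in> grid_V n m \<Longrightarrow> quarter_step n m j p \<in> grid_V n m"
  using path_swap_in[of "fst p" n] path_swap_in[of "snd p" m]
  by (auto simp: quarter_step_def grid_V_def)

lemma quarter_step_invol:
  "p \<in> grid_V n m \<Longrightarrow> quarter_step n m j (quarter_step n m j p) = p"
  using path_swap_invol[of "fst p" n] path_swap_invol[of "snd p" m]
  by (auto simp: quarter_step_def grid_V_def)

lemma quarter_step_cong: "[i = j] (mod 4) \<Longrightarrow> quarter_step n m i = quarter_step n m j"
proof -
  assume *: "[i = j] (mod 4)"
  have "even i = even j" using * by (metis cong_dvd_iff cong_dvd_modulus dvd_triv_left mult_2 numeral_Bit0)
  then show ?thesis using * by (auto simp: quarter_step_def fun_eq_iff cong_def)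
qed

text \<open>In either sense of rotation \<open>s\<close>, column and row exchanges alternate, and
  each kind runs through both of its matchings. They act on different coordinates, so they separate
  into two double swaps.\<close>

lemma four_quarter_steps:
  assumes "s = 1 \<or> s = (-1::int)"
  obtains e e' where "\<And>p. quarter_step n m (j + 3 * s) (quarter_step n m (j + 2 * s)
        (quarter_step n m (j + s) (quarter_step n m j p)))
      = (double_swap e n (fst p), double_swap e' m (snd p))"
proof -
  have j: "j mod 4 = 0 \<or> j mod 4 = 1 \<or> j mod 4 = 2 \<or> j mod 4 = 3" by presburger
  have A: "quarter_step n m i = quarter_step n m (i mod 4)" for i
    by (rule quarter_step_cong) simp
  have B: "(j + 3 * s) mod 4 = (j mod 4 + 3 * s) mod 4" "(j + 2 * s) mod 4 = (j mod 4 + 2 * s) mod 4"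
    "(j + s) mod 4 = (j mod 4 + s) mod 4" by presburger+
  have "\<exists>e e'. \<forall>p. quarter_step n m (j + 3 * s) (quarter_step n m (j + 2 * s)
        (quarter_step n m (j + s) (quarter_step n m j p)))
      = (double_swap e n (fst p), double_swap e' m (snd p))"
    unfolding A[of "j + 3 * s"] A[of "j + 2 * s"] A[of "j + s"] A[of j] B
    using j assms
    by (elim disjE) (simp_all add: quarter_step_def double_swap_def, (metis (full_types))+)
  then show ?thesis using that by blast
qed

lemma double_swap_pair_pow_eq_iff:
  assumes "p \<in> grid_V n m" and \<sigma>: "\<And>p. \<sigma> p = (double_swap e n (fst p), double_swap e' m (snd p))"
  shows "(\<sigma> ^^ i) p = (\<sigma> ^^ j) p \<longleftrightarrow> [i = j] (mod lcm n m)"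
proof -
  have pow: "(\<sigma> ^^ i) p = ((double_swap e n ^^ i) (fst p), (double_swap e' m ^^ i) (snd p))" for i
    by (induction i) (auto simp: \<sigma>)
  have "fst p \<in> {1..n}" "snd p \<in> {1..m}" using assms(1) by (auto simp: grid_V_def)
  then have "(\<sigma> ^^ i) p = (\<sigma> ^^ j) p \<longleftrightarrow> [i = j] (mod n) \<and> [i = j] (mod m)"
    unfolding pow by (simp add: double_swap_pow_eq_iff)
  \<comment> \<open>Over the integers congruence is divisibility of one difference, where the
    universal property of \<open>lcm\<close> joins the two moduli.\<close>
  also have "\<dots> \<longleftrightarrow> [int i = int j] (mod int n) \<and> [int i = int j] (mod int m)"
    by (simp add: cong_int_iff)
  also have "\<dots> \<longleftrightarrow> [int i = int j] (mod (lcm (int n) (int m)))"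
    unfolding cong_iff_dvd_diff lcm_least_iff ..
  also have "\<dots> \<longleftrightarrow> [i = j] (mod lcm n m)"
    by (simp add: cong_int_iff)
  finally show ?thesis .
qed

section \<open>Exchanging occupied circles\<close>

text \<open>Two robots that meet keep their circles; as far as the set of occupied circles is concerned,
  they might as well have exchanged them.\<close>
lemma exchange_step:
  assumes invol: "\<And>p. p \<in> A \<Longrightarrow> \<pi> (\<pi> p) = p"
    and s: "\<And>p. p \<in> A \<Longrightarrow> s p = (if \<pi> p \<in> A then p else \<pi> p)"
  shows "inj_on s A" and "s ` A = \<pi> ` A"
proof -
  show "inj_on s A"
    by (rule inj_onI) (metis invol s)
  show "s ` A = \<pi> ` A"
  proof
    show "s ` A \<subseteq> \<pi> ` A"
    proof
      fix y assume "y \<in> s ` A"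
      then obtain p where "p \<in> A" "y = s p" by blast
      then show "y \<in> \<pi> ` A" using s[of p] invol[of p] by (cases "\<pi> p \<in> A") force+
    qed
    show "\<pi> ` A \<subseteq> s ` A"
    proof
      fix y assume "y \<in> \<pi> ` A"
      then obtain p where "p \<in> A" "y = \<pi> p" by blast
      then show "y \<in> s ` A" using s[of p] s[of "\<pi> p"] invol[of p] by (cases "\<pi> p \<in> A") force+
    qed
  qed
qed

section \<open>Geometry of the grid\<close>

lemma sgn_of_real_times_unit: "d > 0 \<Longrightarrow> cmod w = 1 \<Longrightarrow> sgn (complex_of_real d * w) = w"
  by (simp add: sgn_mult sgn_of_real sgn_div_norm[of w])

lemma sgn_grid_centre:
  assumes "d > 0" "grid_adj p q"
  shows "sgn (grid_centre d q - grid_centre d p) =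
    (if fst q = fst p then (if snd q = snd p + 1 then 1 else - 1)
     else if fst q = fst p + 1 then - \<i> else \<i>)" (is "_ = ?w")
proof -
  have "grid_centre d q - grid_centre d p = complex_of_real d * ?w"
    using assms(2) by (auto simp: grid_centre_def grid_adj_def complex_eq_iff algebra_simps)
  moreover have "cmod ?w = 1" by simp
  ultimately show ?thesis using sgn_of_real_times_unit[OF assms(1)] by simp
qed

lemma mod_4_cases: "(j::int) mod 4 = 0 \<or> j mod 4 = 1 \<or> j mod 4 = 2 \<or> j mod 4 = 3"
  by presburger

lemma even_iff_mod_4: "even (j::int) \<longleftrightarrow> j mod 4 = 0 \<or> j mod 4 = 2"
  by presburger

lemma cis_quarter:
  fixes j :: int
  shows "cis (pi / 2 * of_int j) =
    (if j mod 4 = 0 then 1 else if j mod 4 = 1 then \<i> else if j mod 4 = 2 then - 1 else - \<i>)"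
proof -
  have "pi / 2 * of_int j = pi / 2 * of_int (4 * (j div 4) + j mod 4)" by simp
  also have "\<dots> = 2 * pi * of_int (j div 4) + pi / 2 * of_int (j mod 4)"
    unfolding of_int_add of_int_mult by (simp add: algebra_simps)
  finally have "pi / 2 * of_int j = \<dots>" .
  then have eq: "cis (pi / 2 * of_int j) = cis (2 * pi * of_int (j div 4)) * cis (pi / 2 * of_int (j mod 4))"
    by (simp only: cis_mult)
  have full: "cis (2 * pi * of_int (j div 4)) = 1"
    by (rule cis_multiple_2pi) simp
  have three: "cis (pi / 2 * 3) = - \<i>"
  proof -
    have "pi / 2 * 3 = pi + pi / 2" by simp
    then have "cis (pi / 2 * 3) = cis pi * cis (pi / 2)" by (simp only: cis_mult)
    then show ?thesis by simp
  qed
  show ?thesis using mod_4_cases[of j] three unfolding eq full by (elim disjE) simp_all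
qed

section \<open>Synchronized schedules on the grid, with all angles expressed by the corner
  circle\<close>

locale grid_scs =
  fixes n m :: nat and d r :: real and f g :: "nat \<times> nat \<Rightarrow> real"
  assumes n_pos: "n \<ge> 1" and m_pos: "m \<ge> 1" and d_gt: "d > 2"
    and adj: "\<forall>p\<in>grid_V n m. \<forall>q\<in>grid_V n m.
      comm_adj (grid_V n m) (grid_centre d) r p q \<longleftrightarrow> grid_adj p q"
    and sync: "sync_schedule (grid_V n m) (grid_centre d) r f g"
begin

abbreviation V where "V \<equiv> grid_V n m"
abbreviation c where "c \<equiv> grid_centre d"

lemma adj_iff: "comm_adj V c r p q \<longleftrightarrow> p \<in> V \<and> q \<in> V \<and> grid_adj p q"
  using adj by (auto simp: comm_adj_def)

lemma corner_in: "(1, 1) \<in> V"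
  using n_pos m_pos by (simp add: grid_V_def)

lemma g_cases: "p \<in> V \<Longrightarrow> g p = 1 \<or> g p = - 1"
  using sync by (auto simp: sync_schedule_def)

text \<open>The two robots turn in opposite senses and are at \<open>w\<close> and
  \<open>- w\<close> together at some time, so they always are mirror images in the perpendicular
  bisector of the centres.\<close>

lemma angle_reflect:
  assumes pq: "comm_adj V c r p q" and w: "sgn (c q - c p) = w"
  shows "cis (pos f g q t) = - (w\<^sup>2 * cnj (cis (pos f g p t)))"
proof -
  have p: "p \<in> V" and "q \<in> V" and ne: "p \<noteq> q" using pq by (auto simp: comm_adj_def)
  have gq: "g p = - g q" and link: "\<And>t. at_link c f g p q t \<longleftrightarrow> at_link c f g q p t"
    using sync pq unfolding sync_schedule_def by blast+
  have "c q \<noteq> c p"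
    using ne d_gt by (auto simp: grid_centre_def prod_eq_iff)
  then have nw: "cmod w = 1" using w by (auto simp: norm_sgn)
  \<comment> \<open>A time, possibly negative, at which the schedule of \<open>p\<close> reaches the
    link; synchronization is required at all real times.\<close>
  define t0 where "t0 = (Arg w - f p) / (g p * 2 * pi)"
  have "pos f g p t0 = Arg w"
    using g_cases[OF p] by (auto simp: pos_def t0_def)
  then have pw: "cis (pos f g p t0) = w"
    using nw cis_Arg[of w] by (cases "w = 0") (auto simp: sgn_div_norm)
  then have "at_link c f g p q t0" using w by (simp add: at_link_def)
  then have "cis (pos f g q t0) = sgn (c p - c q)" using link by (simp add: at_link_def)
  also have "\<dots> = - w" using w by (metis minus_diff_eq sgn_minus)
  finally have qw: "cis (pos f g q t0) = - w" .
  define x where "x = g p * 2 * pi * (t - t0)"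
  have "pos f g p t = pos f g p t0 + x" "pos f g q t = pos f g q t0 + - x"
    using gq by (simp_all add: pos_def x_def algebra_simps)
  then have "cis (pos f g p t) = w * cis x" "cis (pos f g q t) = - w * cis (- x)"
    using pw qw by (metis cis_mult)+
  moreover have "w * cnj w = 1" using nw by (simp add: complex_norm_square[symmetric])
  ultimately show ?thesis
    by (simp add: power2_eq_square cis_cnj algebra_simps)
qed

lemma angle_right:
  assumes "(a, b) \<in> V" "(a, b + 1) \<in> V"
  shows "cis (pos f g (a, b + 1) t) = - cnj (cis (pos f g (a, b) t))"
proof -
  have "grid_adj (a, b) (a, b + 1)" by (simp add: grid_adj_def)
  with angle_reflect[of "(a, b)" "(a, b + 1)" 1 t] sgn_grid_centre[of d "(a, b)" "(a, b + 1)"]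
  show ?thesis using assms d_gt by (simp add: adj_iff)
qed

lemma angle_down:
  assumes "(a, b) \<in> V" "(a + 1, b) \<in> V"
  shows "cis (pos f g (a + 1, b) t) = cnj (cis (pos f g (a, b) t))"
proof -
  have "grid_adj (a, b) (a + 1, b)" by (simp add: grid_adj_def)
  with angle_reflect[of "(a, b)" "(a + 1, b)" "- \<i>" t] sgn_grid_centre[of d "(a, b)" "(a + 1, b)"]
  show ?thesis using assms d_gt by (simp add: adj_iff)
qed

text \<open>Reflections composed from the corner down column 1, then along row \<open>a\<close>:
  each row passed flips the imaginary part, each column the real part.\<close>

lemma angle_eq:
  assumes "(a, b) \<in> V"
  shows "cis (pos f g (a, b) t) =
    Complex ((- 1) ^ (b + 1) * Re (cis (pos f g (1, 1) t))) ((- 1) ^ (a + 1) * Im (cis (pos f g (1, 1) t)))"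
    (is "_ = Complex (_ * ?x) (_ * ?y)")
proof -
  have col: "cis (pos f g (a, 1) t) = Complex ?x ((- 1) ^ (a + 1) * ?y)" if "1 \<le> a" "a \<le> n" for a
    using that
  proof (induction a rule: dec_induct)
    case (step a)
    then show ?case using angle_down[of a 1 t] m_pos by (simp add: grid_V_def complex_eq_iff)
  qed (simp add: complex_eq_iff)
  have "1 \<le> b" "b \<le> m" and a: "1 \<le> a" "a \<le> n" using assms by (auto simp: grid_V_def)
  then show ?thesis
  proof (induction b rule: dec_induct)
    case base
    then show ?case using col[of a] by simp
  next
    case (step b)
    then show ?case using angle_right[of a b t] by (simp add: grid_V_def complex_eq_iff)
  qed
qed

text \<open>Links are only passed when the robot on circle \<open>(1, 1)\<close> is at a multiple of \<open>pi / 2\<close>;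
  \<open>event k\<close> is the \<open>k\<close>-th such nonnegative time, \<open>quarter k\<close> the multiple.\<close>

definition phase :: real where "phase = 2 * g (1, 1) * f (1, 1) / pi"
text \<open>\<open>phase\<close> is the starting angle of the corner in quarter turns along its
  direction of motion; \<open>shift\<close> is what it lacks to the next multiple, hence four times
  the waiting time.\<close>

definition shift :: real where "shift = of_int \<lceil>phase\<rceil> - phase"
definition event :: "nat \<Rightarrow> real" where "event k = (real k + shift) / 4"
definition orient :: int where "orient = (if g (1, 1) = 1 then 1 else - 1)"
definition quarter :: "nat \<Rightarrow> int" where "quarter k = orient * (\<lceil>phase\<rceil> + int k)"
definition swap :: "nat \<Rightarrow> nat \<times> nat \<Rightarrow> nat \<times> nat" where "swap k = quarter_step n m (quarter k)"
text \<open>Strictly earlier events are counted, since at a switching instant a robot is still on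
  its old circle.\<close>

definition events_before :: "real \<Rightarrow> nat" where "events_before t = nat \<lceil>4 * t - shift\<rceil>"

lemma shift_bounds: "0 \<le> shift" "shift < 1"
  unfolding shift_def by linarith+

lemma g_corner: "g (1, 1) = of_int orient" "orient = 1 \<or> orient = - 1"
  using g_cases[OF corner_in] by (auto simp: orient_def)

lemma pos_corner: "pos f g (1, 1) t = pi / 2 * (of_int orient * (4 * t + phase))"
  using g_corner by (auto simp: pos_def phase_def field_simps)

lemma pos_corner_event: "pos f g (1, 1) (event k) = pi / 2 * of_int (quarter k)"
proof -
  have "4 * event k = real k + shift" by (simp add: event_def)
  then have "4 * event k + phase = of_int (\<lceil>phase\<rceil> + int k)" by (simp add: shift_def)
  then show ?thesis unfolding pos_corner quarter_def by simp
qed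

lemma event_less_iff [simp]: "event k < event l \<longleftrightarrow> k < l"
  by (simp add: event_def)

lemma event_nonneg [simp]: "0 \<le> event k"
  using shift_bounds by (simp add: event_def)

lemma less_events_before_iff: "k < events_before t \<longleftrightarrow> event k < t"
proof -
  have "k < events_before t \<longleftrightarrow> int k < \<lceil>4 * t - shift\<rceil>"
    unfolding events_before_def by linarith
  also have "\<dots> \<longleftrightarrow> event k < t"
    unfolding less_ceiling_iff event_def by (simp add: algebra_simps)
  finally show ?thesis .
qed

lemma events_before_unique:
  assumes "\<And>k. event k < t \<longleftrightarrow> k < K"
  shows "events_before t = K"
  using assms less_events_before_iff by (metis nat_neq_iff)

lemma events_before_event [simp]: "events_before (event k) = k"
  by (rule events_before_unique) simp

lemma events_before_0 [simp]: "events_before 0 = 0"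
  by (rule events_before_unique) (simp add: not_less)

lemma le_event_events_before: "t \<le> event (events_before t)"
  using less_events_before_iff[of "events_before t" t] by simp

lemma events_before_Suc: "event k < t \<Longrightarrow> t \<le> event (Suc k) \<Longrightarrow> events_before t = Suc k"
  by (metis events_before_event le_less_Suc_eq less_events_before_iff not_less not_less_eq order_less_le_trans)

lemma events_before_plus: "0 \<le> t \<Longrightarrow> events_before (t + real i) = events_before t + 4 * i"
proof -
  assume "0 \<le> t"
  then have "0 \<le> \<lceil>4 * t - shift\<rceil>" using shift_bounds by linarith
  moreover have "\<lceil>4 * (t + real i) - shift\<rceil> = \<lceil>4 * t - shift\<rceil> + 4 * int i"
  proof -
    have "4 * (t + real i) - shift = (4 * t - shift) + of_int (4 * int i)" by simp
    then show ?thesis by (simp only: ceiling_add_of_int)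
  qed
  ultimately show ?thesis by (simp add: events_before_def nat_add_distrib)
qed

text \<open>Every link direction is parallel to an axis, and by \<open>angle_eq\<close> one circle
  is at such a direction only when the corner is.\<close>

lemma link_eventD:
  assumes "link_event V c r f g t" "0 \<le> t"
  obtains k where "t = event k"
proof -
  obtain p q where pq: "comm_adj V c r p q" "at_link c f g p q t"
    using assms(1) by (auto simp: link_event_def)
  obtain a b where p: "p = (a, b)" by (cases p)
  have "(a, b) \<in> V" "grid_adj p q" using pq p by (auto simp: adj_iff)
  then have "Re (cis (pos f g (a, b) t)) = 0 \<or> Im (cis (pos f g (a, b) t)) = 0"
    using pq(2) sgn_grid_centre[of d p q] d_gt by (auto simp: at_link_def p)
  then have "cos (pos f g (1, 1) t) = 0 \<or> sin (pos f g (1, 1) t) = 0"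
    unfolding angle_eq[OF \<open>(a, b) \<in> V\<close>] by simp
  then have "sin (2 * pos f g (1, 1) t) = 0" by (auto simp: sin_double)
  then obtain i :: int where "2 * pos f g (1, 1) t = of_int i * pi"
    by (auto simp: sin_zero_iff_int2)
  then have "pi * (of_int orient * (4 * t + phase)) = pi * of_int i"
    unfolding pos_corner by (simp add: algebra_simps)
  then have "of_int orient * (4 * t + phase) = of_int i"
    using pi_neq_zero mult_left_cancel by blast
  then have "4 * t + phase = of_int (orient * i)"
    using g_corner(2) by auto
  then have z: "4 * t = of_int (orient * i) - phase" by simp
  \<comment> \<open>Nonnegative time excludes multiples before the first event, so the index is a
    natural number.\<close>
  then have "\<lceil>phase\<rceil> \<le> orient * i" using assms(2) by (simp add: ceiling_le_iff)
  then have "t = event (nat (orient * i - \<lceil>phase\<rceil>))"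
    using z by (simp add: event_def shift_def)
  then show ?thesis by (rule that)
qed

section \<open>Exchanges at the events and the orbits of a tour\<close>

lemma swap_in: "p \<in> V \<Longrightarrow> swap k p \<in> V"
  by (simp add: swap_def quarter_step_in)

lemma swap_invol: "p \<in> V \<Longrightarrow> swap k (swap k p) = p"
  by (simp add: swap_def quarter_step_invol)

text \<open>The direction faced names the neighbour. Leftward and upward neighbours are described
  from their own coordinates, which avoids subtraction of natural numbers.\<close>

lemma link_direction_iff:
  "comm_adj V c r p q \<and> at_link c f g p q t \<longleftrightarrow> p \<in> V \<and> q \<in> V \<and>
     (let w = cis (pos f g p t) in
      (w = 1 \<and> q = (fst p, snd p + 1)) \<or> (w = - 1 \<and> p = (fst q, snd q + 1)) \<or>
      (w = - \<i> \<and> q = (fst p + 1, snd p)) \<or> (w = \<i> \<and> p = (fst q + 1, snd q)))"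
proof (cases "p \<in> V \<and> q \<in> V \<and> grid_adj p q")
  case True
  then have s: "sgn (c q - c p) = (if fst q = fst p then (if snd q = snd p + 1 then 1 else - 1)
     else if fst q = fst p + 1 then - \<i> else \<i>)"
    using sgn_grid_centre[of d p q] d_gt by simp
  have lhs: "comm_adj V c r p q \<and> at_link c f g p q t \<longleftrightarrow> cis (pos f g p t) = sgn (c q - c p)"
    using True by (simp add: adj_iff at_link_def)
  obtain a b a' b' where "p = (a, b)" "q = (a', b')" by (metis surj_pair)
  then show ?thesis
    using True unfolding lhs s Let_def grid_adj_def by auto
next
  case False
  then show ?thesis by (auto simp: adj_iff grid_adj_def Let_def prod_eq_iff)
qed

text \<open>Relative to the corner, directions alternate in sign with the column at horizontal
  events and with the row at vertical ones, so circles face each other in pairs. A circle facing the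
  border has no partner and is a fixed point of \<open>swap k\<close>.\<close>

lemma link_iff:
  assumes "p \<in> V"
  shows "comm_adj V c r p q \<and> at_link c f g p q (event k) \<longleftrightarrow> q = swap k p \<and> q \<noteq> p"
proof -
  obtain a b where p: "p = (a, b)" by (cases p)
  obtain a' b' where q: "q = (a', b')" by (cases q)
  let ?j = "quarter k"
  have ab: "1 \<le> a" "a \<le> n" "1 \<le> b" "b \<le> m" using assms by (auto simp: p grid_V_def)
  have w: "cis (pos f g p (event k)) =
    (if ?j mod 4 = 0 then (- 1) ^ (b + 1) else if ?j mod 4 = 1 then (- 1) ^ (a + 1) * \<i>
     else if ?j mod 4 = 2 then - ((- 1) ^ (b + 1)) else - ((- 1) ^ (a + 1) * \<i>))"
    using assms unfolding p angle_eq[OF assms[unfolded p]] pos_corner_event cis_quarter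
    by (cases "even a"; cases "even b") (auto simp: complex_eq_iff)
  have lhs: "comm_adj V c r p q \<and> at_link c f g p q (event k) \<longleftrightarrow> q \<in> V \<and>
     (let w = cis (pos f g p (event k)) in
      (w = 1 \<and> q = (fst p, snd p + 1)) \<or> (w = - 1 \<and> p = (fst q, snd q + 1)) \<or>
      (w = - \<i> \<and> q = (fst p + 1, snd p)) \<or> (w = \<i> \<and> p = (fst q + 1, snd q)))"
    using assms unfolding link_direction_iff by blast
  have ne: "\<i> \<noteq> - \<i>" "1 \<noteq> - \<i>" "- 1 \<noteq> - \<i>" "- 1 \<noteq> (1 :: complex)" "- 1 \<noteq> \<i>" "1 \<noteq> \<i>"
    by (auto simp: complex_eq_iff)
  note ne = ne ne[symmetric]
  consider "?j mod 4 = 0" | "?j mod 4 = 1" | "?j mod 4 = 2" | "?j mod 4 = 3"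
    using mod_4_cases[of ?j] by blast
  then show ?thesis
  proof cases
    case 1
    show ?thesis unfolding lhs w Let_def using ab ne 1
      by (cases "even b") (auto simp: p q swap_def quarter_step_def even_iff_mod_4 path_swap_def grid_V_def)
  next
    case 2
    show ?thesis unfolding lhs w Let_def using ab ne 2
      by (cases "even a") (auto simp: p q swap_def quarter_step_def even_iff_mod_4 path_swap_def grid_V_def)
  next
    case 3
    show ?thesis unfolding lhs w Let_def using ab ne 3
      by (cases "even b") (auto simp: p q swap_def quarter_step_def even_iff_mod_4 path_swap_def grid_V_def)
  next
    case 4
    show ?thesis unfolding lhs w Let_def using ab ne 4
      by (cases "even a") (auto simp: p q swap_def quarter_step_def even_iff_mod_4 path_swap_def grid_V_def)
  qed
qed

text \<open>The motion during one time unit, starting just before the \<open>k\<close>-th event, when every robot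
  passes every link it reaches.\<close>
definition tour :: "nat \<Rightarrow> nat \<times> nat \<Rightarrow> nat \<times> nat" where
  "tour k p = swap (k + 3) (swap (k + 2) (swap (k + 1) (swap k p)))"

lemma tour_in: "p \<in> V \<Longrightarrow> tour k p \<in> V"
  by (simp add: tour_def swap_in)

lemma tour_pow_in: "p \<in> V \<Longrightarrow> (tour k ^^ i) p \<in> V"
  by (induction i) (auto simp: tour_in)

lemma swap_add_4: "swap (k + 4) = swap k"
  unfolding swap_def
  by (rule quarter_step_cong) (simp add: quarter_def cong_iff_dvd_diff algebra_simps)

lemma tour_add_4: "tour (k + 4 * i) = tour k"
proof (induction i)
  case (Suc i)
  have "tour (l + 4) = tour l" for l
    using swap_add_4[of l] swap_add_4[of "l + 1"] swap_add_4[of "l + 2"] swap_add_4[of "l + 3"]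
    by (intro ext) (simp add: tour_def add.commute add.left_commute)
  from this[of "k + 4 * i"] Suc show ?case by (simp add: algebra_simps)
qed simp

lemma tour_pow_eq_iff:
  assumes "p \<in> V"
  shows "(tour k ^^ i) p = (tour k ^^ j) p \<longleftrightarrow> [i = j] (mod lcm n m)"
proof -
  have q: "quarter (k + i) = quarter k + int i * orient" for i
    by (simp add: quarter_def algebra_simps)
  obtain e e' where "\<And>p. quarter_step n m (quarter k + 3 * orient) (quarter_step n m (quarter k + 2 * orient)
        (quarter_step n m (quarter k + orient) (quarter_step n m (quarter k) p)))
      = (double_swap e n (fst p), double_swap e' m (snd p))"
    using four_quarter_steps[OF g_corner(2)] by blast
  then have "\<And>p. tour k p = (double_swap e n (fst p), double_swap e' m (snd p))"
    using q[of 1] q[of 2] q[of 3] by (simp add: tour_def swap_def)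
  then show ?thesis by (rule double_swap_pair_pow_eq_iff[OF assms])
qed

lemma tour_pow_lcm: "p \<in> V \<Longrightarrow> (tour k ^^ (i * lcm n m)) p = p"
  using tour_pow_eq_iff[where p = p and j = 0] by (simp add: cong_0_iff)

lemma lcm_pos: "0 < lcm n m"
  using n_pos m_pos by (intro lcm_pos_nat) auto

lemma orbit_card:
  assumes "p \<in> V"
  shows "card ((\<lambda>i. (tour k ^^ i) p) ` {..<lcm n m}) = lcm n m"
proof -
  have "inj_on (\<lambda>i. (tour k ^^ i) p) {..<lcm n m}"
    using tour_pow_eq_iff[OF assms] by (auto intro!: inj_onI simp: cong_def)
  then show ?thesis by (simp add: card_image)
qed

lemma orbit_range:
  assumes "p \<in> V"
  shows "(tour k ^^ i) p \<in> (\<lambda>i. (tour k ^^ i) p) ` {..<lcm n m}"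
proof -
  have "(tour k ^^ i) p = (tour k ^^ (i mod lcm n m)) p"
    using tour_pow_eq_iff[OF assms] by (simp add: cong_def)
  then show ?thesis using lcm_pos by auto
qed

text \<open>Stated for any family of sets that evolves by the swaps: it serves arbitrary runs after
  the last departure as well as the explicit run further on.\<close>

lemma tour_pow_image:
  assumes "\<And>l. l \<ge> k \<Longrightarrow> A (Suc l) = swap l ` A l"
  shows "A (k + 4 * i) = (tour k ^^ i) ` A k"
proof (induction i)
  case (Suc i)
  let ?l = "k + 4 * i"
  have "A (k + 4 * Suc i) = tour ?l ` A ?l"
    using assms[of ?l] assms[of "?l + 1"] assms[of "?l + 2"] assms[of "?l + 3"]
    by (simp add: tour_def image_image numeral_eq_Suc)
  then show ?case by (simp add: tour_add_4 Suc image_image)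
qed simp

section \<open>Runs\<close>

context
  fixes S :: "(nat \<times> nat) set" and tau :: "nat \<times> nat \<Rightarrow> real" and L :: "nat \<times> nat \<Rightarrow> real \<Rightarrow> nat \<times> nat"
  assumes run: "is_run V c r f g S tau L"
begin

lemma run_init: "q \<in> V \<Longrightarrow> L q 0 = q"
  using run by (simp add: is_run_def)

lemma run_const:
  "q \<in> V \<Longrightarrow> 0 \<le> s \<Longrightarrow> s < t \<Longrightarrow> (\<And>u. s \<le> u \<Longrightarrow> u < t \<Longrightarrow> \<not> link_event V c r f g u) \<Longrightarrow> L q t = L q s"
  using run unfolding is_run_def by blast

text \<open>The reference is the first event at or after \<open>t\<close>, because circles are
  constant from just after one event up to and including the next.\<close>

lemma run_at_event:
  assumes "q \<in> V" "0 \<le> t"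
  shows "L q t = L q (event (events_before t))"
proof (cases "t = event (events_before t)")
  case False
  then have less: "t < event (events_before t)"
    using le_event_events_before[of t] by simp
  have "L q (event (events_before t)) = L q t"
  proof (rule run_const[OF assms less])
    fix u assume u: "t \<le> u" "u < event (events_before t)"
    show "\<not> link_event V c r f g u"
    proof
      assume "link_event V c r f g u"
      then obtain k where "u = event k" using link_eventD u assms by (metis order_trans)
      then show False using u less_events_before_iff[of k t] by simp
    qed
  qed
  then show ?thesis ..
qed simp

lemma run_step:
  assumes q: "q \<in> V" and pr: "present S tau q (event k)" and LV: "L q (event k) \<in> V"
  defines "p \<equiv> L q (event k)"
  shows "L q (event (Suc k)) =
    (if occupied V S tau L (swap k p) (event k) then p else swap k p)"
proof (cases "link_event V c r f g (event k)")
  case True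
  have free_iff: "comm_adj V c r p j \<and> at_link c f g p j (event k) \<and> \<not> occupied V S tau L j (event k)
      \<longleftrightarrow> j = swap k p \<and> \<not> occupied V S tau L j (event k)" for j
  proof -
    have "occupied V S tau L p (event k)" using q pr by (auto simp: occupied_def p_def)
    \<comment> \<open>A robot occupies its own circle, so a free \<open>j\<close> differs from
      \<open>p\<close>; for a circle without partner nothing is free.\<close>
    then show ?thesis using link_iff[of p j k] LV by (auto simp: p_def)
  qed
  obtain \<delta> where "\<delta> > 0" and \<delta>: "\<And>t. event k < t \<Longrightarrow> t < event k + \<delta> \<Longrightarrow>
      (if (\<exists>j. comm_adj V c r p j \<and> at_link c f g p j (event k) \<and> \<not> occupied V S tau L j (event k))
       then comm_adj V c r p (L q t) \<and> at_link c f g p (L q t) (event k)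
                \<and> \<not> occupied V S tau L (L q t) (event k)
           else L q t = p)"
    using run q pr True event_nonneg[of k] unfolding is_run_def p_def by blast
  \<comment> \<open>Within \<delta> of the event, where the switching rule speaks, yet no later than
    the next event, so that \<open>run_at_event\<close> carries the result there.\<close>
  define t where "t = min (event k + \<delta> / 2) (event (Suc k))"
  have t: "event k < t" "t < event k + \<delta>" "t \<le> event (Suc k)"
    using \<open>\<delta> > 0\<close> by (auto simp: t_def min_def)
  then have "L q t = L q (event (Suc k))"
    using run_at_event[OF q, of t] events_before_Suc[of k t] event_nonneg[of k] by simp
  then show ?thesis using \<delta>[OF t(1,2)] unfolding free_iff by auto
next
  case False
  have "L q (event (Suc k)) = L q (event k)"
  proof (rule run_const[OF q])
    fix u assume u: "event k \<le> u" "u < event (Suc k)"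
    show "\<not> link_event V c r f g u"
    proof
      assume l: "link_event V c r f g u"
      then obtain l where l: "u = event l" using link_eventD u event_nonneg[of k] by (metis order_trans)
      then have "l = k" using u by (metis event_less_iff less_antisym not_less)
      then show False using l False \<open>link_event V c r f g u\<close> by simp
    qed
  qed auto
  moreover have "swap k p = p"
    using link_iff[of p "swap k p" k] LV False unfolding p_def link_event_def by blast
  ultimately show ?thesis by (simp add: p_def)
qed

text \<open>The same robots, those present at \<open>event k\<close>, are compared at both events.
  Departures in between only shrink this set, which preserves injectivity.\<close>

lemma run_exchange:
  assumes "inj_on (\<lambda>q. L q (event k)) {q \<in> V. present S tau q (event k)}" (is "inj_on ?M ?Q")
    and "(\<lambda>q. L q (event k)) ` {q \<in> V. present S tau q (event k)} \<subseteq> V"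
  shows "inj_on (\<lambda>q. L q (event (Suc k))) {q \<in> V. present S tau q (event k)}"
    and "(\<lambda>q. L q (event (Suc k))) ` {q \<in> V. present S tau q (event k)}
      = swap k ` (\<lambda>q. L q (event k)) ` {q \<in> V. present S tau q (event k)}"
proof -
  define s where "s p = (if swap k p \<in> ?M ` ?Q then p else swap k p)" for p
  have occ: "occupied V S tau L p (event k) \<longleftrightarrow> p \<in> ?M ` ?Q" for p
    by (auto simp: occupied_def)
  have step: "L q (event (Suc k)) = s (?M q)" if "q \<in> ?Q" for q
    using run_step[of q k] that assms(2) unfolding occ s_def by auto
  have inv: "\<And>p. p \<in> ?M ` ?Q \<Longrightarrow> swap k (swap k p) = p"
    using assms(2) swap_invol by blast
  note ex = exchange_step[OF inv s_def]
  have "inj_on (s \<circ> ?M) ?Q"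
    by (intro comp_inj_on assms(1) ex(1)) simp_all
  then show "inj_on (\<lambda>q. L q (event (Suc k))) ?Q"
    using step by (simp add: inj_on_def)
  have "(\<lambda>q. L q (event (Suc k))) ` ?Q = s ` ?M ` ?Q"
    unfolding image_image using step by (rule image_cong[OF refl])
  also have "\<dots> = swap k ` ?M ` ?Q" by (intro ex(2)) simp_all
  finally show "(\<lambda>q. L q (event (Suc k))) ` ?Q = swap k ` ?M ` ?Q" .
qed

lemma run_inj:
  "inj_on (\<lambda>q. L q (event k)) {q \<in> V. present S tau q (event k)}
   \<and> (\<lambda>q. L q (event k)) ` {q \<in> V. present S tau q (event k)} \<subseteq> V"
proof (induction k)
  case 0
  have "L q (event 0) = q" if "q \<in> V" for q
    using run_at_event[of q 0] run_init that by simp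
  then show ?case by (auto simp: inj_on_def)
next
  case (Suc k)
  have sub: "{q \<in> V. present S tau q (event (Suc k))} \<subseteq> {q \<in> V. present S tau q (event k)}"
    using event_less_iff[of k "Suc k"] by (auto simp: present_def simp del: event_less_iff)
  have "swap k ` (\<lambda>q. L q (event k)) ` {q \<in> V. present S tau q (event k)} \<subseteq> V"
    using Suc swap_in by blast
  then show ?case
    using run_exchange[of k] Suc sub by (metis (no_types, lifting) image_mono inj_on_subset subset_trans)
qed

section \<open>Coverage by the surviving robots\<close>

lemma run_covered:
  assumes S: "S \<subseteq> V" and card: "card S < lcm n m" and p: "p \<in> V"
  shows "covered V f g S L p"
proof -
  define A where "A k = (\<lambda>q. L q (event k)) ` (V - S)" for k
  have fin: "finite V" by (simp add: grid_V_def)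
  \<comment> \<open>From \<open>B\<close> on all robots of \<open>S\<close> have left, and the
    survivors' circles evolve by the swaps alone.\<close>
  obtain B where B: "0 \<le> B" "\<And>q. q \<in> S \<Longrightarrow> tau q \<le> B"
  proof
    have "finite S" using S fin by (rule finite_subset)
    then show "tau q \<le> (\<Sum>q\<in>S. \<bar>tau q\<bar>)" if "q \<in> S" for q
      using member_le_sum[of q S "\<lambda>q. \<bar>tau q\<bar>"] that by simp
    show "0 \<le> (\<Sum>q\<in>S. \<bar>tau q\<bar>)" by (rule sum_nonneg) simp
  qed
  have left: "{q \<in> V. present S tau q (event k)} = V - S" if "B \<le> event k" for k
    using B that by (force simp: present_def)
  have A_step: "A (Suc k) = swap k ` A k" if "B \<le> event k" for k
    using run_exchange(2)[of k] run_inj[of k] unfolding left[OF that] A_def by blast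
  have A_card: "card (A k) + card S = card V" and A_sub: "A k \<subseteq> V" if "B \<le> event k" for k
    using run_inj[of k] unfolding left[OF that] A_def
    by (auto simp: card_image card_Diff_subset finite_subset[OF S fin] S card_mono[OF fin S])
  define P where "P = B + 2 + real (lcm n m)"
  have "\<exists>t\<ge>T. t \<le> T + P \<and> (\<exists>q\<in>V - S. L q t = p \<and> cis (pos f g p t) = cis \<theta>)" if T: "T \<ge> 0" for \<theta> T
  proof -
    \<comment> \<open>\<open>x\<close> solves for angle \<theta> on \<open>p\<close>. Adding an
      integer keeps the angle, as a time unit is one tour, and the ceiling brings \<open>t\<close>
      to at least \<open>T\<close> and \<open>B\<close>.\<close>
    define x where "x = (\<theta> - f p) / (g p * 2 * pi)"
    define t where "t = x + of_int \<lceil>max T B - x\<rceil>"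
    have t: "T \<le> t" "B \<le> t" "t \<le> T + B + 1" using T B(1) unfolding t_def by linarith+
    define k where "k = events_before t"
    have Bk: "B \<le> event k" using t(2) le_event_events_before[of t] by (simp add: k_def)
    define R where "R = (\<lambda>i. (tour k ^^ i) p) ` {..<lcm n m}"
    \<comment> \<open>Pigeonhole: the orbit has \<open>lcm n m\<close> circles, while only
      \<open>card S\<close> circles are empty.\<close>
    have "R \<inter> A k \<noteq> {}"
    proof
      assume "R \<inter> A k = {}"
      moreover have "R \<subseteq> V" using tour_pow_in[OF p] by (auto simp: R_def)
      ultimately have "card R + card (A k) \<le> card V"
        using A_sub[OF Bk] fin by (metis Un_least card_Un_disjoint card_mono finite_subset)
      then show False using A_card[OF Bk] card orbit_card[OF p, of k] by (simp add: R_def)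
    qed
    then obtain i where i: "i < lcm n m" "(tour k ^^ i) p \<in> A k" by (auto simp: R_def)
    \<comment> \<open>The tours still missing for the \<open>i\<close>-th iterate to return to
      \<open>p\<close>.\<close>
    define j where "j = lcm n m - i"
    have "(tour k ^^ j) ((tour k ^^ i) p) = (tour k ^^ (j + i)) p" by (simp add: funpow_add)
    also have "\<dots> = p" using tour_pow_lcm[OF p, where i = 1] i(1) by (simp add: j_def)
    finally have "p \<in> (tour k ^^ j) ` A k" using i(2) by (metis imageI)
    also have "(tour k ^^ j) ` A k = A (k + 4 * j)"
    proof (rule tour_pow_image[symmetric])
      fix l assume "l \<ge> k"
      then have "event k \<le> event l" by (metis event_less_iff not_less)
      then show "A (Suc l) = swap l ` A l" using A_step Bk by simp
    qed
    also have "k + 4 * j = events_before (t + real j)"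
      using events_before_plus[of t j] t B by (simp add: k_def)
    finally obtain q where q: "q \<in> V - S" "L q (t + real j) = p"
      using run_at_event[of _ "t + real j"] t B by (auto simp: A_def)
    have "pos f g p (t + real j) = pos f g p x + 2 * pi * of_int (orient' * (\<lceil>max T B - x\<rceil> + int j))"
      if "g p = of_int orient'" for orient'
      using that by (simp add: pos_def t_def algebra_simps)
    moreover obtain orient' :: int where "g p = of_int orient'"
      using g_cases[OF p] by (metis of_int_1 of_int_minus)
    ultimately have "cis (pos f g p (t + real j)) = cis (pos f g p x)"
      by (metis Ints_of_int cis_mult cis_multiple_2pi mult.right_neutral)
    also have "pos f g p x = \<theta>" using g_cases[OF p] by (auto simp: pos_def x_def)
    finally have "cis (pos f g p (t + real j)) = cis \<theta>" .
    moreover have "T \<le> t + real j" "t + real j \<le> T + P" using t by (auto simp: P_def j_def)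
    ultimately show ?thesis using q by blast
  qed
  moreover have "P > 0" using B by (simp add: P_def)
  ultimately show ?thesis unfolding covered_def by blast
qed

end

section \<open>The two bounds on the resilience\<close>

lemma resilient: "k < lcm n m \<Longrightarrow> resilient_for V c r f g k"
  unfolding resilient_for_def using run_covered by blast

text \<open>Circles at the \<open>k\<close>-th event of the run in which the robots in \<open>S\<close> leave at time 0.\<close>
primrec circle_at :: "(nat \<times> nat) set \<Rightarrow> nat \<Rightarrow> nat \<times> nat \<Rightarrow> nat \<times> nat" where
  "circle_at S 0 = (\<lambda>q. q)"
| "circle_at S (Suc k) = (\<lambda>q. if swap k (circle_at S k q) \<in> circle_at S k ` (V - S)
     then circle_at S k q else swap k (circle_at S k q))"

lemma circle_at_in: "q \<in> V \<Longrightarrow> circle_at S k q \<in> V"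
  by (induction k) (auto simp: swap_in)

lemma circle_at_Suc_image: "circle_at S (Suc k) ` (V - S) = swap k ` circle_at S k ` (V - S)"
proof -
  define s where "s p = (if swap k p \<in> circle_at S k ` (V - S) then p else swap k p)" for p
  have "circle_at S (Suc k) ` (V - S) = s ` circle_at S k ` (V - S)"
    unfolding image_image by (rule image_cong) (simp_all add: s_def)
  also have "\<dots> = swap k ` circle_at S k ` (V - S)"
    by (rule exchange_step(2)) (auto simp: swap_invol circle_at_in s_def)
  finally show ?thesis .
qed

text \<open>Refuting resilience takes an actual run. Constancy between events also concerns the
  robots in \<open>S\<close>, whose formal circles follow the same recursion.\<close>

lemma circle_at_run:
  "is_run V c r f g S (\<lambda>_. 0) (\<lambda>q t. circle_at S (events_before t) q)" (is "is_run _ _ _ _ _ _ ?tau ?L")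
proof -
  have const: "?L q t = ?L q s"
    if q: "q \<in> V" and st: "0 \<le> s" "s < t" and no: "\<forall>u. s \<le> u \<and> u < t \<longrightarrow> \<not> link_event V c r f g u" for q s t
  proof -
    have le: "events_before s \<le> events_before t"
      using st by (metis less_events_before_iff not_less order_less_trans less_irrefl)
    have "circle_at S l q = circle_at S (events_before s) q"
      if "events_before s \<le> l" "l \<le> events_before t" for l
      using that
    proof (induction l rule: dec_induct)
      case (step l)
      then have "s \<le> event l" "event l < t"
        using less_events_before_iff[of l s] less_events_before_iff[of l t] by auto
      then have "\<not> link_event V c r f g (event l)" using no by blast
      then have "swap l (circle_at S l q) = circle_at S l q"
        using link_iff[OF circle_at_in[OF q], of S l "swap l (circle_at S l q)" l]
        unfolding link_event_def by blast
      then show ?case using step by simp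
    qed simp
    then show ?thesis using le by blast
  qed
  have jump: "\<exists>\<delta>>0. \<forall>t. u < t \<and> t < u + \<delta> \<longrightarrow>
      (if \<exists>j. comm_adj V c r (?L q u) j \<and> at_link c f g (?L q u) j u \<and> \<not> occupied V S ?tau ?L j u
       then comm_adj V c r (?L q u) (?L q t) \<and> at_link c f g (?L q u) (?L q t) u
         \<and> \<not> occupied V S ?tau ?L (?L q t) u
       else ?L q t = ?L q u)"
    if q: "q \<in> V" and u: "0 \<le> u" "link_event V c r f g u" and pr: "present S ?tau q u" for q u
  proof -
    obtain k where k: "u = event k" using link_eventD u by blast
    let ?p = "circle_at S k q"
    have qS: "q \<in> V - S" using pr q u by (auto simp: present_def)
    have occ: "occupied V S ?tau ?L j (event k) \<longleftrightarrow> j \<in> circle_at S k ` (V - S)" for j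
      by (auto simp: occupied_def present_def leD[OF event_nonneg])
    have free: "comm_adj V c r ?p j \<and> at_link c f g ?p j (event k) \<and> j \<notin> circle_at S k ` (V - S)
      \<longleftrightarrow> j = swap k ?p \<and> j \<notin> circle_at S k ` (V - S)" for j
      using link_iff[OF circle_at_in[OF q], of S k j k] qS by auto
    \<comment> \<open>Consecutive events are a quarter unit apart, so exactly one more event is
      counted.\<close>
    have "?L q t = circle_at S (Suc k) q" if "u < t" "t < u + 1 / 4" for t
    proof -
      have "t \<le> event (Suc k)" using that by (simp add: k event_def add_divide_distrib)
      then show ?thesis using events_before_Suc that(1) k by simp
    qed
    then show ?thesis
      unfolding k events_before_event occ free
      by (intro exI[of _ "1 / 4"]) auto
  qed
  show ?thesis
    unfolding is_run_def using const jump by simp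
qed

lemma not_resilient:
  assumes "lcm n m \<le> k" "k \<le> card V"
  shows "\<not> resilient_for V c r f g k"
proof
  assume res: "resilient_for V c r f g k"
  let ?p = "(1, 1) :: nat \<times> nat"
  define R where "R = (\<lambda>i. (tour 0 ^^ i) ?p) ` {..<lcm n m}"
  have "finite V" by (simp add: grid_V_def)
  moreover have "R \<subseteq> V" using tour_pow_in[OF corner_in] by (auto simp: R_def)
  moreover have "card R = lcm n m" using orbit_card[OF corner_in, of 0] by (simp add: R_def)
  \<comment> \<open>The whole orbit of the corner leaves, padded with other robots to exactly
    \<open>k\<close>.\<close>
  ultimately obtain S where S: "R \<subseteq> S" "S \<subseteq> V" "card S = k"
    using exists_subset_between[of R k V] assms by auto
  define A where "A l = circle_at S l ` (V - S)" for l
  have A: "A (4 * N) = (tour 0 ^^ N) ` (V - S)" for N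
    using tour_pow_image[of 0 A N] circle_at_Suc_image by (simp add: A_def)
  have "covered V f g S (\<lambda>q t. circle_at S (events_before t) q) ?p"
    using res S circle_at_run corner_in unfolding resilient_for_def by (metis order_refl)
  \<comment> \<open>Coverage is tested at the corner's starting angle, which its schedule attains
    only at integer times; the occupied circles are then images of \<open>V - S\<close> under whole
    tours.\<close>
  then obtain t q where t: "0 \<le> t" and q: "q \<in> V - S" "circle_at S (events_before t) q = ?p"
    and angle: "cis (pos f g ?p t) = cis (f ?p)"
    unfolding covered_def by (metis order_refl)
  obtain i :: int where "g ?p * 2 * pi * t = 2 * pi * of_int i"
  proof -
    have "cis (f ?p) * cis (g ?p * 2 * pi * t) = cis (f ?p)"
      using angle by (simp add: pos_def cis_mult)
    then have "cis (g ?p * 2 * pi * t) = 1" by simp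
    then have "cos (g ?p * 2 * pi * t) = 1" by (simp add: complex_eq_iff)
    then show ?thesis using that by (auto simp: cos_one_2pi_int mult.commute)
  qed
  then have "2 * pi * (g ?p * t) = 2 * pi * of_int i" by (simp add: algebra_simps)
  then have "g ?p * t = of_int i" by simp
  then have "t = \<bar>of_int i\<bar>" using g_cases[OF corner_in] t by auto
  then have tN: "t = real (nat \<bar>i\<bar>)" by simp
  define N where "N = nat \<bar>i\<bar>"
  have "events_before t = 4 * N" using events_before_plus[of 0 N] tN by (simp add: N_def)
  then have "?p \<in> A (4 * N)" using q unfolding A_def by (metis imageI)
  then obtain y where y: "y \<in> V - S" "(tour 0 ^^ N) y = ?p" by (auto simp: A)
  \<comment> \<open>As \<open>lcm n m\<close> tours are the identity, \<open>N * l\<close> further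
    tours undo the first \<open>N\<close>. Hence \<open>y\<close> lies in the corner's orbit and so
    in \<open>S\<close>.\<close>
  define l where "l = lcm n m - 1"
  have "y = (tour 0 ^^ (N * lcm n m)) y" using tour_pow_lcm y by simp
  also have "N * lcm n m = N * l + N" using lcm_pos unfolding l_def by (cases "lcm n m") auto
  also have "(tour 0 ^^ (N * l + N)) y = (tour 0 ^^ (N * l)) ?p"
    using y by (simp add: funpow_add)
  also have "\<dots> \<in> R" unfolding R_def by (rule orbit_range[OF corner_in])
  finally show False using y S by blast
qed

lemma resilience: "uncovering_resilience V c r f g = lcm n m - 1"
  unfolding uncovering_resilience_def
proof (rule Greatest_equality)
  have "lcm n m \<le> n * m" using n_pos m_pos by (intro dvd_imp_le) auto
  then show "lcm n m - 1 \<le> card V \<and> resilient_for V c r f g (lcm n m - 1)"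
    using lcm_pos resilient[of "lcm n m - 1"] by (simp add: grid_V_def)
next
  fix k assume "k \<le> card V \<and> resilient_for V c r f g k"
  then show "k \<le> lcm n m - 1" using not_resilient[of k] by linarith
qed

end

theorem theorem6:
  fixes n m :: nat and d r :: real and f g :: "nat \<times> nat \<Rightarrow> real"
  assumes "n \<ge> 1" and "m \<ge> 1"
    and "d > 2" and "r > 0"
    and "\<forall>p\<in>grid_V n m. \<forall>q\<in>grid_V n m. comm_adj (grid_V n m) (grid_centre d) r p q \<longleftrightarrow> grid_adj p q"
    and "sync_schedule (grid_V n m) (grid_centre d) r f g"
  shows "uncovering_resilience (grid_V n m) (grid_centre d) r f g = n * m div gcd n m - 1"
proof -
  interpret grid_scs n m d r f g
    using assms by unfold_locales auto
  show ?thesis using resilience by (simp add: lcm_nat_def)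
qed

end
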